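(* There exists $n_0$ such that every connected graph $G$ on $n \geq n_0$ vertices in which every vertex has degree at least $4$ satisfies $b(G) \leq \lceil \sqrt{n} \rceil$.
   Context: Burning process on a graph $G$: at step $1$ one vertex is set on fire; at every step $i \geq 2$, all neighbours of vertices on fire catch fire, and additionally one new vertex is set on fire. $G$ is $k$-burnable if some choice of vertices makes the whole graph on fire at the end of step $k$. The burning number $b(G)$ is the least $k$ such that $G$ is $k$-burnable. Equivalently, $b(G)$ is the least $k$ such that there are vertices $v_1,\dots,v_k$ with $\bigcup_{i=1}^{k} N_{k-i}[v_i] = V(G)$, where $N_r[v]$ is the set of vertices at distance at most $r$ from $v$. *)

theory Defs
  imports Complex_Main "Graph_Theory.Graph_Theory"
begin

text \<open>
  Finite simple graphs are those of the locale \<^locale>\<open>graph\<close>: finite symmetric digraphs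
  without loops and parallel arcs. An undirected edge is a pair of opposite arcs, so the degree of
  a vertex is its \<^const>\<open>out_degree\<close> (equivalently, its in-degree).
\<close>

text \<open>
  The set of vertices on fire at the end of step \<open>i\<close>, where \<open>v i\<close> is the vertex chosen in step
  \<open>i\<close>. Steps are numbered from 1, nothing burns at time 0, and so \<open>v 0\<close> is irrelevant. The chosen
  vertex may be one that is on fire already, as in the description of burning by coverings with
  balls of radii \<open>k - 1, \<dots>, 0\<close>.
\<close>
primrec on_fire :: "('a, 'b) pre_digraph \<Rightarrow> (nat \<Rightarrow> 'a) \<Rightarrow> nat \<Rightarrow> 'a set" where
  "on_fire G v 0 = {}"
| "on_fire G v (Suc i) =
     on_fire G v i \<union> {w. \<exists>u \<in> on_fire G v i. u \<rightarrow>\<^bsub>G\<^esub> w} \<union> {v (Suc i)}"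

definition burnable :: "('a, 'b) pre_digraph \<Rightarrow> nat \<Rightarrow> bool" where
  "burnable G k \<longleftrightarrow>
     (\<exists>v. (\<forall>i \<in> {1..k}. v i \<in> verts G) \<and> on_fire G v k = verts G)"

definition burning_number :: "('a, 'b) pre_digraph \<Rightarrow> nat" where
  "burning_number G = (LEAST k. burnable G k)"

lemma (in wf_digraph) on_fire_subset_verts:
  assumes "\<forall>i \<in> {1..k}. v i \<in> verts G"
  shows "on_fire G v k \<subseteq> verts G"
  using assms by (induction k) (auto simp: arcs_ends_conv)

lemma chosen_on_fire: "v ` {1..k} \<subseteq> on_fire G v k"
  by (induction k) (auto simp: atLeastAtMostSuc_conv)

lemma (in fin_digraph) burnable_card_verts: "burnable G (card (verts G))"
proof -
  obtain v where "bij_betw v {1..card (verts G)} (verts G)"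
    using ex_bij_betw_nat_finite_1[OF finite_verts] by blast
  then have v: "v ` {1..card (verts G)} = verts G"
    by (rule bij_betw_imp_surj_on)
  then have "on_fire G v (card (verts G)) = verts G"
    using on_fire_subset_verts[of "card (verts G)" v] chosen_on_fire[of v "card (verts G)" G]
    by blast
  with v show ?thesis
    unfolding burnable_def by blast
qed

lemma (in fin_digraph) burnable_burning_number: "burnable G (burning_number G)"
  unfolding burning_number_def by (rule LeastI) (rule burnable_card_verts)

end

theory Submission
  imports Defs
begin

text \<open>
  Minimum degree 4 makes a maximal family of disjoint closed neighbourhoods have at most \<open>n/5\<close>
  members, and their centres can be joined by a tree with at most \<open>3n/5\<close> vertices that meets every
  ball of radius 2. It remains to cover this tree by balls of radii \<open>0, \<dots>, k - 3\<close>, where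
  \<open>k = \<lceil>\<surd>n\<rceil>\<close>, and to enlarge each radius by 2. The covering is greedy: given radii
  \<open>r \<le> m \<le> 2r\<close>, one can cut a subtree off that is either covered by radius \<open>r\<close> and has more than \<open>m\<close>
  vertices, or is covered by radius \<open>m\<close> and has more than \<open>2r\<close> vertices. Applying this to the smallest
  and the largest of the radii in \<open>[3M/5, M)\<close> until they are used up removes at least
  \<open>(39/100) M\<^sup>2\<close> vertices, up to lower-order terms. Iterating over geometrically shrinking \<open>M\<close>,
  the radii below \<open>M\<close> cover \<open>(39/64 - o(1)) M\<^sup>2\<close> vertices, and \<open>39/64 > 3/5\<close>.
\<close>

section \<open>Balls and coverings\<close>

definition ball_of :: "('a \<Rightarrow> 'a \<Rightarrow> bool) \<Rightarrow> nat \<Rightarrow> 'a \<Rightarrow> 'a set" where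
  "ball_of E r u = {w. \<exists>i\<le>r. (E ^^ i) u w}"

text \<open>Each radius has a single centre, so it is spent at most once. Only the centres are
  confined to \<open>C\<close>; distances are measured by \<open>E\<close> alone. As
  \<open>c\<close> is total, \<open>C\<close> is forced to be nonempty.\<close>

definition coverable :: "('a \<Rightarrow> 'a \<Rightarrow> bool) \<Rightarrow> 'a set \<Rightarrow> nat set \<Rightarrow> 'a set \<Rightarrow> bool" where
  "coverable E C R X \<longleftrightarrow> (\<exists>c. range c \<subseteq> C \<and> X \<subseteq> (\<Union>r\<in>R. ball_of E r (c r)))"

lemma ball_ofI: "(E ^^ i) u w \<Longrightarrow> i \<le> r \<Longrightarrow> w \<in> ball_of E r u"
  unfolding ball_of_def by blast

lemma centre_in_ball_of: "u \<in> ball_of E r u"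
  by (rule ball_ofI[of 0]) auto

lemma ball_of_mono: "r \<le> s \<Longrightarrow> ball_of E r u \<subseteq> ball_of E s u"
  unfolding ball_of_def using le_trans by blast

lemma ball_of_Suc: "ball_of E (Suc r) u = ball_of E r u \<union> {w. \<exists>x \<in> ball_of E r u. E x w}"
proof (intro equalityI subsetI)
  fix w assume "w \<in> ball_of E (Suc r) u"
  then obtain i where i: "i \<le> Suc r" "(E ^^ i) u w"
    unfolding ball_of_def by blast
  show "w \<in> ball_of E r u \<union> {w. \<exists>x \<in> ball_of E r u. E x w}"
  proof (cases i)
    case 0
    with i show ?thesis by (auto intro: ball_ofI[of 0])
  next
    case (Suc j)
    with i obtain x where "(E ^^ j) u x" "E x w" by auto
    with i Suc show ?thesis by (auto intro: ball_ofI)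
  qed
next
  fix w assume "w \<in> ball_of E r u \<union> {w. \<exists>x \<in> ball_of E r u. E x w}"
  then show "w \<in> ball_of E (Suc r) u"
    unfolding ball_of_def by (auto intro: le_SucI) (metis Suc_le_mono relpowp_Suc_I)
qed

lemma ball_of_1: "ball_of E 1 u = insert u {w. E u w}"
  unfolding One_nat_def ball_of_Suc by (auto simp: ball_of_def)

lemma ball_of_trans:
  assumes "w \<in> ball_of E r u" "x \<in> ball_of E s w"
  shows "x \<in> ball_of E (r + s) u"
proof -
  from assms obtain i j where "i \<le> r" "(E ^^ i) u w" "j \<le> s" "(E ^^ j) w x"
    unfolding ball_of_def by blast
  then have "(E ^^ (i + j)) u x" "i + j \<le> r + s"
    by (auto simp: relpowp_add)
  then show ?thesis by (rule ball_ofI)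
qed

lemma relpowp_sym:
  assumes "symp E" "(E ^^ n) x y"
  shows "(E ^^ n) y x"
  using assms(2)
proof (induction n arbitrary: y)
  case (Suc n)
  then obtain w where "(E ^^ n) x w" "E w y" by auto
  with Suc.IH assms(1) have "E y w" "(E ^^ n) w x" by (auto dest: sympD)
  then show ?case by (rule relpowp_Suc_I2)
qed auto

lemma ball_of_sym: "symp E \<Longrightarrow> w \<in> ball_of E r u \<Longrightarrow> u \<in> ball_of E r w"
  unfolding ball_of_def using relpowp_sym by fast

lemma coverable_empty: "C \<noteq> {} \<Longrightarrow> coverable E C R {}"
  unfolding coverable_def by auto

text \<open>The covering of \<open>Y\<close> does not use \<open>r\<close>, so the centre of
  \<open>r\<close> can be moved to \<open>u\<close> without uncovering anything in
  \<open>Y\<close>.\<close>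

lemma coverable_step:
  assumes "coverable E C (R - {r}) Y" "r \<in> R" "u \<in> C" "X - Y \<subseteq> ball_of E r u"
  shows "coverable E C R X"
proof -
  from assms(1) obtain c where c: "range c \<subseteq> C" "Y \<subseteq> (\<Union>s\<in>R - {r}. ball_of E s (c s))"
    unfolding coverable_def by blast
  have "range (c(r := u)) \<subseteq> C" using c assms by auto
  moreover have "X \<subseteq> (\<Union>s\<in>R. ball_of E s ((c(r := u)) s))"
  proof
    fix x assume "x \<in> X"
    show "x \<in> (\<Union>s\<in>R. ball_of E s ((c(r := u)) s))"
    proof (cases "x \<in> Y")
      case True
      with c obtain s where "s \<in> R" "s \<noteq> r" "x \<in> ball_of E s (c s)" by blast
      then show ?thesis by (intro UN_I[of s]) auto
    next
      case False
      with \<open>x \<in> X\<close> assms show ?thesis by (intro UN_I[of r]) auto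
    qed
  qed
  ultimately show ?thesis unfolding coverable_def by blast
qed

section \<open>Covering rooted trees\<close>

locale rooted_tree =
  fixes E :: "'a \<Rightarrow> 'a \<Rightarrow> bool" and T :: "'a set" and par :: "'a \<Rightarrow> 'a" and dep :: "'a \<Rightarrow> nat"
  assumes sym: "symp E"
    and finite: "finite T"
    and nonempty: "T \<noteq> {}"
    and par_in: "x \<in> T \<Longrightarrow> 0 < dep x \<Longrightarrow> par x \<in> T"
    and par_adj: "x \<in> T \<Longrightarrow> 0 < dep x \<Longrightarrow> E x (par x)"
    and dep_par: "x \<in> T \<Longrightarrow> 0 < dep x \<Longrightarrow> Suc (dep (par x)) = dep x"
    and root_unique: "x \<in> T \<Longrightarrow> y \<in> T \<Longrightarrow> dep x = 0 \<Longrightarrow> dep y = 0 \<Longrightarrow> x = y"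
begin

text \<open>These sets are the subtrees that contain the root, and the empty set: the possible
  remainders after repeated pruning.\<close>

definition par_closed :: "'a set \<Rightarrow> bool" where
  "par_closed X \<longleftrightarrow> X \<subseteq> T \<and> (\<forall>x\<in>X. 0 < dep x \<longrightarrow> par x \<in> X)"

lemma ancestor:
  assumes "par_closed X" "x \<in> X" "i \<le> dep x"
  shows "(par ^^ i) x \<in> X" "dep ((par ^^ i) x) = dep x - i" "(E ^^ i) x ((par ^^ i) x)"
proof -
  from assms(3) have "(par ^^ i) x \<in> X \<and> dep ((par ^^ i) x) = dep x - i \<and> (E ^^ i) x ((par ^^ i) x)"
  proof (induction i)
    case 0
    with assms(2) show ?case by simp
  next
    case (Suc i)
    let ?y = "(par ^^ i) x"
    have y: "?y \<in> X" "dep ?y = dep x - i" "(E ^^ i) x ?y" using Suc by auto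
    then have "?y \<in> T" "0 < dep ?y" using assms(1) Suc.prems by (auto simp: par_closed_def)
    moreover from this have "par ?y \<in> X" using assms(1) y unfolding par_closed_def by blast
    ultimately show ?case using y dep_par[of ?y] par_adj[of ?y] by auto
  qed
  then show "(par ^^ i) x \<in> X" "dep ((par ^^ i) x) = dep x - i" "(E ^^ i) x ((par ^^ i) x)"
    by blast+
qed

lemma ancestors_inj:
  assumes "par_closed X" "x \<in> X" "k \<le> Suc (dep x)"
  shows "inj_on (\<lambda>i. (par ^^ i) x) {..<k}"
proof (rule inj_onI)
  fix i j assume "i \<in> {..<k}" "j \<in> {..<k}" "(par ^^ i) x = (par ^^ j) x"
  then have "dep x - i = dep x - j" "i \<le> dep x" "j \<le> dep x"
    using ancestor(2)[OF assms(1,2)] assms(3) by (metis lessThan_iff less_Suc_eq_le order_less_le_trans)+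
  then show "i = j" by linarith
qed

text \<open>
  Cut off the subtree of a deepest vertex \<open>l\<close> that is rooted at height \<open>m\<close> above \<open>l\<close>. It lies in the ball of radius
  \<open>m\<close> around its root. The ball of radius \<open>r\<close> around the ancestor of \<open>l\<close> at height \<open>r\<close> contains the
  path from \<open>l\<close> up to height \<open>2 * r\<close>, so it can only miss a vertex that lies deep inside another
  branch, which then adds at least \<open>2 * r - m + 1\<close> vertices to the \<open>m + 1\<close> on the path.
\<close>
lemma prune:
  assumes X: "par_closed X" "X \<noteq> {}" and "r \<le> m" "m \<le> 2 * r"
  obtains u where "u \<in> T" "X \<subseteq> ball_of E m u"
  | Y u where "par_closed Y" "u \<in> T" "X - Y \<subseteq> ball_of E r u" "card Y + m + 1 \<le> card X"
  | Y u where "par_closed Y" "u \<in> T" "X - Y \<subseteq> ball_of E m u" "card Y + 2 * r + 2 \<le> card X"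
proof -
  have XT: "X \<subseteq> T" using X(1) unfolding par_closed_def by blast
  have finX: "finite X" using XT finite finite_subset by blast
  then have "Max (dep ` X) \<in> dep ` X" using X(2) by simp
  then obtain l where l: "l \<in> X" "dep l = Max (dep ` X)" by (metis imageE)
  then have l_max: "dep x \<le> dep l" if "x \<in> X" for x using finX that by simp
  note anc = ancestor[OF X(1)]
  show thesis
  proof (cases "dep l \<le> m")
    case True
    let ?u = "(par ^^ dep l) l"
    have u: "?u \<in> T" "dep ?u = 0" using anc[OF l(1) order_refl] XT by auto
    have "X \<subseteq> ball_of E m ?u"
    proof
      fix x assume x: "x \<in> X"
      from anc[OF x order_refl] have "(par ^^ dep x) x \<in> T" "dep ((par ^^ dep x) x) = 0"
        "(E ^^ dep x) x ((par ^^ dep x) x)"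
        using XT by auto
      then have "(E ^^ dep x) x ?u" using root_unique u by metis
      then show "x \<in> ball_of E m ?u"
        using relpowp_sym[OF sym] l_max[OF x] True by (auto intro!: ball_ofI[of "dep x"])
    qed
    with that(1) u show thesis by blast
  next
    case False
    define p where "p s = (par ^^ s) l" for s
    have p: "p s \<in> X" "dep (p s) = dep l - s" if "s \<le> m" for s
      using anc[OF l(1), of s] that False unfolding p_def by auto
    define P where "P = p ` {..<Suc m}"
    have cardP: "card P = m + 1"
      unfolding P_def p_def by (subst card_image) (use ancestors_inj[OF X(1) l(1)] False in auto)
    \<comment> \<open>\<open>D\<close> is what \<open>X\<close> contains of the subtree rooted at
      \<open>p m\<close>.\<close>
    define D where "D = {x \<in> X. \<exists>i\<le>dep x. (par ^^ i) x = p m}"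
    have finD: "finite D" and DX: "D \<subseteq> X" using finX unfolding D_def by auto
    have PD: "P \<subseteq> D"
    proof
      fix x assume "x \<in> P"
      then obtain s where s: "s \<le> m" "x = p s"
        unfolding P_def by (metis imageE lessThan_iff less_Suc_eq_le)
      have "(par ^^ (m - s)) x = p m"
        using s unfolding p_def by (simp flip: funpow_add comp_apply[of "par ^^ _" "par ^^ _"])
      moreover have "m - s \<le> dep x" using s p(2) False by auto
      ultimately show "x \<in> D" unfolding D_def using s p by auto
    qed
    have closed: "par_closed (X - D)"
      unfolding par_closed_def
    proof (intro conjI ballI impI)
      show "X - D \<subseteq> T" using XT by blast
      fix y assume y: "y \<in> X - D" "0 < dep y"
      then have "par y \<in> X" using X(1) unfolding par_closed_def by blast
      moreover have "par y \<notin> D"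
      proof
        assume "par y \<in> D"
        then obtain i where "i \<le> dep (par y)" "(par ^^ i) (par y) = p m" unfolding D_def by auto
        then have "Suc i \<le> dep y" "(par ^^ Suc i) y = p m"
          using dep_par[of y] y XT by (auto simp: funpow_swap1)
        with y show False unfolding D_def by blast
      qed
      ultimately show "par y \<in> X - D" by blast
    qed
    have XD: "X - (X - D) = D" using DX by blast
    have cardX: "card X = card (X - D) + card D"
      using card_Diff_subset[OF finD DX] card_mono[OF finX DX] by simp
    have Dm: "D \<subseteq> ball_of E m (p m)"
    proof
      fix x assume "x \<in> D"
      then obtain i where i: "x \<in> X" "i \<le> dep x" "(par ^^ i) x = p m" unfolding D_def by auto
      from anc[OF i(1,2)] i(3) have "dep (p m) = dep x - i" "(E ^^ i) x (p m)" by auto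
      moreover from this have "i \<le> m" using p(2)[of m] l_max[OF i(1)] i(2) False by auto
      ultimately show "x \<in> ball_of E m (p m)" using relpowp_sym[OF sym] by (blast intro: ball_ofI)
    qed
    show thesis
    proof (cases "D \<subseteq> ball_of E r (p r)")
      case True
      have "card P \<le> card D" using card_mono[OF finD PD] .
      with that(2)[OF closed] True XD cardX cardP p(1)[of r] XT \<open>r \<le> m\<close> show thesis by auto
    next
      case False
      then obtain x where x: "x \<in> D" "x \<notin> ball_of E r (p r)" by blast
      then obtain I where I: "x \<in> X" "I \<le> dep x" "(par ^^ I) x = p m" unfolding D_def by auto
      \<comment> \<open>\<open>i\<close> counts the vertices on the way up from \<open>x\<close>
        before the path \<open>P\<close> is met, at \<open>p s\<close>.\<close>
      define i where "i = (LEAST i. (par ^^ i) x \<in> P)"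
      have "(par ^^ I) x \<in> P" using I unfolding P_def by auto
      then have i: "(par ^^ i) x \<in> P" "i \<le> I"
        unfolding i_def by (auto intro: LeastI Least_le)
      have i_min: "(par ^^ j) x \<notin> P" if "j < i" for j
        using that not_less_Least unfolding i_def by blast
      from i obtain s where s: "s \<le> m" "(par ^^ i) x = p s"
        unfolding P_def by (metis imageE lessThan_iff less_Suc_eq_le)
      have idep: "i \<le> dep x" using i I by linarith
      have ex: "(E ^^ i) (p s) x" using anc(3)[OF I(1) idep] s relpowp_sym[OF sym] by metis
      have "dep x - i = dep l - s" using anc(2)[OF I(1) idep] s p(2) by metis
      \<comment> \<open>A branch leaving the path at height \<open>s\<close> cannot go deeper than
        \<open>l\<close>.\<close>
      then have "i \<le> s" using l_max[OF I(1)] idep s \<open>\<not> dep l \<le> m\<close> by linarith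
      \<comment> \<open>Going from \<open>p r\<close> along \<open>P\<close> to \<open>p s\<close>
        and down to \<open>x\<close> takes \<open>|r - s| + i\<close> steps. If
        \<open>s + i \<le> 2 * r\<close>, this is at most \<open>r\<close>: by
        \<open>i \<le> s\<close> when \<open>s \<le> r\<close>, and directly otherwise.\<close>
      have far: "2 * r < s + i"
      proof (rule ccontr)
        assume "\<not> 2 * r < s + i"
        have "p s \<in> ball_of E (if s \<le> r then r - s else s - r) (p r)"
        proof (cases "s \<le> r")
          case True
          have "(par ^^ (r - s)) (p s) = p r"
            using True unfolding p_def by (simp flip: funpow_add comp_apply[of "par ^^ _" "par ^^ _"])
          moreover have "r - s \<le> dep (p s)" using p(2)[OF s(1)] \<open>r \<le> m\<close> \<open>\<not> dep l \<le> m\<close> by linarith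
          ultimately have "(E ^^ (r - s)) (p s) (p r)"
            using anc(3)[OF p(1)[OF s(1)]] by metis
          then show ?thesis using relpowp_sym[OF sym] True by (auto intro: ball_ofI)
        next
          case False
          have "(par ^^ (s - r)) (p r) = p s"
            using False unfolding p_def by (simp flip: funpow_add comp_apply[of "par ^^ _" "par ^^ _"])
          moreover have "s - r \<le> dep (p r)" using p(2)[OF \<open>r \<le> m\<close>] s \<open>\<not> dep l \<le> m\<close> by linarith
          ultimately have "(E ^^ (s - r)) (p r) (p s)"
            using anc(3)[OF p(1)[OF \<open>r \<le> m\<close>]] by metis
          then show ?thesis using False by (auto intro: ball_ofI)
        qed
        then have "x \<in> ball_of E ((if s \<le> r then r - s else s - r) + i) (p r)"
          using ex by (blast intro: ball_of_trans ball_ofI)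
        moreover have "(if s \<le> r then r - s else s - r) + i \<le> r"
          using \<open>\<not> 2 * r < s + i\<close> \<open>i \<le> s\<close> by auto
        ultimately show False using x(2) ball_of_mono by (metis subsetD)
      qed
      define B where "B = (\<lambda>j. (par ^^ j) x) ` {..<i}"
      have cardB: "card B = i"
        unfolding B_def by (subst card_image) (use ancestors_inj[OF X(1) I(1)] idep in auto)
      have "B \<subseteq> D"
      proof
        fix y assume "y \<in> B"
        then obtain j where j: "j < i" "y = (par ^^ j) x" unfolding B_def by auto
        have "(par ^^ (I - j)) y = p m"
          using j i I by (simp flip: funpow_add comp_apply[of "par ^^ _" "par ^^ _"])
        moreover have "y \<in> X" "I - j \<le> dep y" using anc(1,2)[OF I(1), of j] j idep I by auto
        ultimately show "y \<in> D" unfolding D_def by blast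
      qed
      moreover have "B \<inter> P = {}" using i_min unfolding B_def by auto
      ultimately have "card P + card B \<le> card D"
        using PD finD by (metis Un_least card_Un_disjoint card_mono finite_subset inf_commute)
      \<comment> \<open>Since \<open>s \<le> m\<close>, the branch has at least
        \<open>2 * r + 1 - m\<close> vertices off the path.\<close>
      then have "card (X - D) + 2 * r + 2 \<le> card X"
        using cardX cardP cardB far s by linarith
      with that(3)[OF closed, of "p m"] XD Dm p(1)[of m] XT show thesis by auto
    qed
  qed
qed

text \<open>This is \<open>prune\<close> with \<open>r = a\<close> and \<open>m = b - 1\<close>; its
  gains \<open>m + 1\<close> and \<open>2 * r + 2\<close> become \<open>b\<close> and
  \<open>2 * a + 2\<close>. The radii below \<open>p\<close> are kept in reserve.\<close>

lemma coverable_interval_step: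
  assumes X: "par_closed X" and pab: "p \<le> a" "a < b" "b \<le> 2 * a + 1"
    and low: "\<And>Y. par_closed Y \<Longrightarrow> card Y + b \<le> card X \<Longrightarrow>
      coverable E T ({..<p} \<union> {Suc a..<b}) Y"
    and high: "\<And>Y. par_closed Y \<Longrightarrow> card Y + 2 * a + 2 \<le> card X \<Longrightarrow>
      coverable E T ({..<p} \<union> {a..<b - 1}) Y"
  shows "coverable E T ({..<p} \<union> {a..<b}) X"
proof (cases "X = {}")
  case True
  then show ?thesis by (simp add: coverable_empty nonempty)
next
  case False
  have R: "({..<p} \<union> {a..<b}) - {a} = {..<p} \<union> {Suc a..<b}"
    "({..<p} \<union> {a..<b}) - {b - 1} = {..<p} \<union> {a..<b - 1}"
    using pab by auto
  have mem: "a \<in> {..<p} \<union> {a..<b}" "b - 1 \<in> {..<p} \<union> {a..<b}" using pab by auto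
  have "a \<le> b - 1" "b - 1 \<le> 2 * a" using pab by auto
  from X False this show ?thesis
  proof (cases rule: prune)
    case (1 u)
    then show ?thesis
      using coverable_step[OF coverable_empty[OF nonempty] mem(2), of u X E] by simp
  next
    case (2 Y u)
    then have "coverable E T ({..<p} \<union> {a..<b} - {a}) Y" unfolding R(1) using pab by (intro low) auto
    then show ?thesis using mem(1) 2(2,3) by (rule coverable_step)
  next
    case (3 Y u)
    then have "coverable E T ({..<p} \<union> {a..<b} - {b - 1}) Y" unfolding R(2) by (intro high) auto
    then show ?thesis using mem(2) 3(2,3) by (rule coverable_step)
  qed
qed

text \<open>
  The bounds of the next two lemmas form one potential \<open>g(a, b)\<close> for the radii in \<open>[a, b)\<close>: it loses at
  most \<open>b\<close> when \<open>a\<close> is used and at most \<open>2a + 2\<close> when \<open>b - 1\<close> is used. It is \<open>b(b - a)\<close> for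
  \<open>b \<le> 3a/2\<close> and \<open>2ab - 9a\<^sup>2/4 = b(b - a) - (b - 3a/2)\<^sup>2\<close> beyond.
\<close>
lemma coverable_short_interval:
  fixes f :: real
  assumes base: "\<And>Y. par_closed Y \<Longrightarrow> real (card Y) \<le> f \<Longrightarrow> coverable E T {..<p} Y"
  assumes "par_closed X" "p \<le> a" "2 * (a + d) \<le> 3 * a + 3" "real (card X) \<le> f + real (a + d) * d"
  shows "coverable E T ({..<p} \<union> {a..<a + d}) X"
  using assms(2-)
proof (induction d arbitrary: a X)
  case 0
  then show ?case using base[of X] by simp
next
  case (Suc d)
  show ?case
  proof (rule coverable_interval_step)
    fix Y assume Y: "par_closed Y" "card Y + (a + Suc d) \<le> card X"
    then have "real (card Y) + real (a + Suc d) \<le> real (card X)" by linarith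
    then have "real (card Y) \<le> f + real (Suc a + d) * d"
      using Suc.prems by (simp add: algebra_simps)
    with Suc.IH[of Y "Suc a"] Y Suc.prems
    show "coverable E T ({..<p} \<union> {Suc a..<a + Suc d}) Y" by simp
  next
    fix Y assume Y: "par_closed Y" "card Y + 2 * a + 2 \<le> card X"
    then have "real (card Y) + 2 * a + 2 \<le> real (card X)" by linarith
    \<comment> \<open>Giving up the largest radius lowers the potential by
      \<open>a + 2 * d + 1\<close>, which this bounds by \<open>2 * a + 2\<close>.\<close>
    moreover have "2 * d \<le> a + 1" using Suc.prems(3) by simp
    then have "2 * real d \<le> real a + 1" by linarith
    ultimately have "real (card Y) \<le> f + real (a + d) * d"
      using Suc.prems by (simp add: algebra_simps)
    with Suc.IH[of Y a] Y Suc.prems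
    show "coverable E T ({..<p} \<union> {a..<a + Suc d - 1}) Y" by simp
  qed (use Suc.prems in auto)
qed

lemma coverable_long_interval:
  fixes f :: real
  assumes base: "\<And>Y. par_closed Y \<Longrightarrow> real (card Y) \<le> f \<Longrightarrow> coverable E T {..<p} Y"
  assumes "par_closed X" "p \<le> a" "d \<le> a + 1"
    "4 * real (card X) \<le> 4 * f + 8 * real a * real (a + d) - 9 * (real a)\<^sup>2"
  shows "coverable E T ({..<p} \<union> {a..<a + d}) X"
  using assms(2-)
proof (induction d arbitrary: a X)
  case 0
  have "8 * real a * real a - 9 * (real a)\<^sup>2 \<le> 0" by (simp add: power2_eq_square)
  with 0(4) have "real (card X) \<le> f" by simp
  with 0(1) have "coverable E T {..<p} X" by (rule base)
  then show ?case by simp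
next
  case (Suc d)
  show ?case
  proof (cases "2 * (a + Suc d) \<le> 3 * a + 1")
    case True
    \<comment> \<open>With \<open>b = a + Suc d\<close>, this square is the gap between
      \<open>4b(b - a)\<close> and \<open>8ab - 9a^2\<close>, so the short-interval bound is the
      weaker demand on \<open>X\<close>.\<close>
    have "0 \<le> (2 * real (a + Suc d) - 3 * real a)\<^sup>2" by simp
    then have "real (card X) \<le> f + real (a + Suc d) * real (Suc d)"
      using Suc.prems by (simp add: algebra_simps power2_eq_square)
    then show ?thesis
      by (intro coverable_short_interval[where f = f]) (use base True Suc.prems in auto)
  next
    case False
    show ?thesis
    proof (rule coverable_interval_step)
      fix Y assume Y: "par_closed Y" "card Y + (a + Suc d) \<le> card X"
      then have "real (card Y) + real (a + Suc d) \<le> real (card X)" by linarith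
      \<comment> \<open>Raising \<open>a\<close> by one with \<open>b = a + Suc d\<close> fixed
        changes \<open>8ab - 9a^2\<close> by \<open>8b - 18a - 9\<close>, which is at least
        \<open>-4b\<close> by this inequality.\<close>
      moreover have "3 * real a + 2 \<le> 2 * real (a + Suc d)" using False by linarith
      ultimately have "4 * real (card Y) \<le> 4 * f + 8 * real (Suc a) * real (Suc a + d)
          - 9 * (real (Suc a))\<^sup>2"
        using Suc.prems(4) by (simp add: algebra_simps power2_eq_square)
      with Suc.IH[of Y "Suc a"] Y Suc.prems
      show "coverable E T ({..<p} \<union> {Suc a..<a + Suc d}) Y" by simp
    next
      fix Y assume Y: "par_closed Y" "card Y + 2 * a + 2 \<le> card X"
      then have "real (card Y) + 2 * a + 2 \<le> real (card X)" by linarith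
      then have "4 * real (card Y) \<le> 4 * f + 8 * real a * real (a + d) - 9 * (real a)\<^sup>2"
        using Suc.prems(4) by (simp add: algebra_simps)
      with Suc.IH[of Y a] Y Suc.prems
      show "coverable E T ({..<p} \<union> {a..<a + Suc d - 1}) Y" by simp
    qed (use Suc.prems in auto)
  qed
qed

text \<open>
  Any factor strictly between \<open>3/5\<close> and \<open>39/64\<close> would do; the constant makes the bound void for
  \<open>M \<le> 100\<close>, where the rounding of \<open>3M/5\<close> matters.
\<close>
lemma coverable_initial_segment:
  assumes "par_closed X" "real (card X) \<le> 121/200 * (real M)\<^sup>2 - 6050"
  shows "coverable E T {..<M} X"
  using assms
proof (induction M arbitrary: X rule: less_induct)
  case (less M)
  show ?case
  proof (cases "M \<le> 100")
    case True
    then have "(real M)\<^sup>2 \<le> 100\<^sup>2" by (intro power_mono) auto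
    then have "card X = 0" using less.prems by simp
    moreover have "finite X" using less.prems(1) finite finite_subset unfolding par_closed_def by blast
    ultimately have "X = {}" by simp
    then show ?thesis by (simp add: coverable_empty nonempty)
  next
    case False
    \<comment> \<open>\<open>p\<close> is \<open>3M/5\<close> rounded up. The radii from
      \<open>p\<close> on are spent now; those below \<open>p\<close> are left to the induction
      hypothesis.\<close>
    define p where "p = (3 * M + 4) div 5"
    have p: "5 * p \<le> 3 * M + 4" "3 * M \<le> 5 * p" unfolding p_def by linarith+
    then have "p < M" using False by linarith
    define e where "e = real p - 3/5 * real M"
    have e: "0 \<le> e" "e \<le> 4/5" unfolding e_def using p by linarith+
    have pe: "real p = 3/5 * real M + e" unfolding e_def by simp
    have "e\<^sup>2 \<le> (4/5)\<^sup>2" using e by (intro power_mono) auto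
    moreover have "100\<^sup>2 \<le> (real M)\<^sup>2" using False by (intro power_mono) auto
    moreover have "0 \<le> real M * e" using e by simp
    \<comment> \<open>The right side minus the left is
      \<open>0.0112 M^2 + 0.104 M e - 6.58 e^2\<close>; the rounding term is below 5.\<close>
    ultimately have "4 * (121/200 * (real M)\<^sup>2 - 6050)
        \<le> 4 * (121/200 * (real p)\<^sup>2 - 6050) + 8 * real p * real M - 9 * (real p)\<^sup>2"
      unfolding pe by (simp add: algebra_simps power2_eq_square)
    then have "4 * real (card X)
        \<le> 4 * (121/200 * (real p)\<^sup>2 - 6050) + 8 * real p * real (p + (M - p)) - 9 * (real p)\<^sup>2"
      using less.prems \<open>p < M\<close> by simp
    then have "coverable E T ({..<p} \<union> {p..<p + (M - p)}) X"
      by (rule coverable_long_interval[where f = "121/200 * (real p)\<^sup>2 - 6050", rotated 4])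
        (use less p \<open>p < M\<close> in auto)
    moreover have "{..<p} \<union> {p..<p + (M - p)} = {..<M}" using \<open>p < M\<close> by auto
    ultimately show ?thesis by simp
  qed
qed

lemma par_closed_tree: "par_closed T"
  unfolding par_closed_def using par_in by blast

end

section \<open>Small trees that dominate within distance two\<close>

text \<open>\<open>w\<close> may already lie in \<open>T\<close>, so a path can be attached without
  asking where it meets the tree again.\<close>

inductive grown :: "('a \<Rightarrow> 'a \<Rightarrow> bool) \<Rightarrow> 'a set \<Rightarrow> bool" for E where
  single: "grown E {v}"
| extend: "grown E T \<Longrightarrow> u \<in> T \<Longrightarrow> E u w \<Longrightarrow> grown E (insert w T)"

text \<open>A new vertex is hung below \<open>u\<close>, one level deeper; a vertex already present
  keeps its parent and depth.\<close>

lemma grown_rooted_tree: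
  assumes "grown E T" "symp E"
  shows "\<exists>par dep. rooted_tree E T par dep"
  using assms(1)
proof induction
  case (single v)
  have "rooted_tree E {v} id (\<lambda>_. 0)"
    by unfold_locales (use assms(2) in auto)
  then show ?case by blast
next
  case (extend T u w)
  then obtain par dep where "rooted_tree E T par dep" by blast
  then interpret rooted_tree E T par dep .
  show ?case
  proof (cases "w \<in> T")
    case True
    with rooted_tree_axioms show ?thesis by (auto simp: insert_absorb)
  next
    case False
    have "rooted_tree E (insert w T) (par(w := u)) (dep(w := Suc (dep u)))"
    proof unfold_locales
      fix x assume "x \<in> insert w T" "0 < (dep(w := Suc (dep u))) x"
      then show "(par(w := u)) x \<in> insert w T" "E x ((par(w := u)) x)"
        "Suc ((dep(w := Suc (dep u))) ((par(w := u)) x)) = (dep(w := Suc (dep u))) x"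
        using par_in[of x] par_adj[of x] dep_par[of x] extend.hyps sympD[OF assms(2)] False
        by (auto split: if_splits)
    next
      fix x y assume "x \<in> insert w T" "y \<in> insert w T" "(dep(w := Suc (dep u))) x = 0"
        "(dep(w := Suc (dep u))) y = 0"
      then show "x = y" using root_unique by (auto split: if_splits)
    qed (use assms(2) finite in auto)
    then show ?thesis by blast
  qed
qed

text \<open>
  Take a maximal set \<open>S\<close> of centres with disjoint closed neighbourhoods that lies in a tree with at
  most \<open>3 * card S\<close> vertices. A vertex at distance exactly 3 from \<open>S\<close> could be added to it at the
  price of three tree vertices.
\<close>
lemma distance_two_dominating_tree:
  assumes "symp E" "finite V" "V \<noteq> {}"
    and in_V: "\<And>u w. E u w \<Longrightarrow> w \<in> V"
    and conn: "\<And>u w. u \<in> V \<Longrightarrow> w \<in> V \<Longrightarrow> E\<^sup>*\<^sup>* u w"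
    and large: "\<And>u. u \<in> V \<Longrightarrow> d \<le> card (ball_of E 1 u)"
  obtains T where "T \<subseteq> V" "grown E T" "d * card T \<le> 3 * card V" "V \<subseteq> (\<Union>u\<in>T. ball_of E 2 u)"
proof -
  define good where "good S T \<longleftrightarrow> S \<subseteq> T \<and> T \<subseteq> V \<and> grown E T \<and> card T \<le> 3 * card S \<and>
    S \<noteq> {} \<and> disjoint_family_on (ball_of E 1) S" for S T
  let ?A = "{S. \<exists>T. good S T}"
  have "?A \<subseteq> Pow V" unfolding good_def by blast
  then have "finite ?A" using assms(2) finite_subset by blast
  moreover obtain v where "v \<in> V" using assms(3) by blast
  then have "good {v} {v}" unfolding good_def by (auto intro: grown.single simp: disjoint_family_on_def)
  then have "?A \<noteq> {}" by blast
  ultimately obtain S where S: "S \<in> ?A" and max: "\<And>S'. S' \<in> ?A \<Longrightarrow> S \<subseteq> S' \<Longrightarrow> S = S'"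
    using finite_has_maximal by metis
  then obtain T where T: "S \<subseteq> T" "T \<subseteq> V" "grown E T" "card T \<le> 3 * card S" "S \<noteq> {}"
    and disj: "disjoint_family_on (ball_of E 1) S"
    unfolding good_def by blast
  have finT: "finite T" using finite_subset[OF T(2) assms(2)] .
  have finS: "finite S" using finite_subset[OF T(1) finT] .
  define U where "U = (\<Union>s\<in>S. ball_of E 2 s)"
  \<comment> \<open>\<open>U\<close> is closed under adjacency, so connectedness makes it all of
    \<open>V\<close>.\<close>
  have no_cross: "x \<in> U" if "y \<in> U" "E y x" for x y
  proof (rule ccontr)
    assume x: "x \<notin> U"
    from that obtain s i where s: "s \<in> S" "i \<le> 2" "(E ^^ i) s y" unfolding U_def ball_of_def by blast
    then have "(E ^^ Suc i) s x" using that(2) by auto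
    then have "x \<in> ball_of E 2 s" if "Suc i \<le> 2" using that by (rule ball_ofI)
    then have "\<not> Suc i \<le> 2" using x s(1) unfolding U_def by blast
    \<comment> \<open>So \<open>x\<close> is reached from \<open>s\<close> by a path through
      \<open>z\<close> and \<open>y\<close>: \<open>S\<close> gains one centre for at most three new
      tree vertices.\<close>
    then have "i = Suc (Suc 0)" using s by simp
    then obtain z where z: "E s z" "E z y" using s by auto
    define T' where "T' = insert x (insert y (insert z T))"
    have "grown E T'"
      unfolding T'_def using T s z that
      by (intro grown.extend[of _ _ y x] grown.extend[of _ _ z y] grown.extend[of _ _ s z]) auto
    have "x \<notin> S" using x centre_in_ball_of unfolding U_def by fast
    have "card T' \<le> Suc (Suc (Suc (card T)))"
      unfolding T'_def using finT by (simp add: card_insert_if)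
    then have "card T' \<le> 3 * card (insert x S)" using T \<open>x \<notin> S\<close> finS by simp
    moreover have "ball_of E 1 x \<inter> ball_of E 1 t = {}" if "t \<in> S" for t
    proof (rule ccontr)
      assume "ball_of E 1 x \<inter> ball_of E 1 t \<noteq> {}"
      \<comment> \<open>A common vertex of the two closed neighbourhoods would put \<open>x\<close>
        within distance 2 of \<open>t\<close>, hence into \<open>U\<close>.\<close>
      then have "x \<in> ball_of E (1 + 1) t"
        using ball_of_trans[of _ E 1 t x 1] ball_of_sym[OF assms(1), of _ 1 x] by auto
      with that x show False unfolding U_def by (auto simp: numeral_2_eq_2)
    qed
    then have "disjoint_family_on (ball_of E 1) (insert x S)"
      using disj \<open>x \<notin> S\<close> by (subst disjoint_family_on_insert) auto
    ultimately have "good (insert x S) T'"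
      unfolding good_def using T \<open>grown E T'\<close> in_V[OF z(1)] in_V[OF z(2)] in_V[OF that(2)]
      unfolding T'_def by auto
    then show False using max[of "insert x S"] \<open>x \<notin> S\<close> by blast
  qed
  have VU: "V \<subseteq> U"
  proof
    fix w assume "w \<in> V"
    obtain s where "s \<in> S" using T by blast
    then have "E\<^sup>*\<^sup>* s w" using conn \<open>w \<in> V\<close> T by blast
    moreover have "s \<in> U" using \<open>s \<in> S\<close> centre_in_ball_of[of s E 2] unfolding U_def by blast
    ultimately show "w \<in> U" by induction (use no_cross in auto)
  qed
  have "ball_of E 1 s \<subseteq> V" if "s \<in> S" for s
    using that T in_V centre_in_ball_of unfolding ball_of_def by (auto simp: le_Suc_eq)
  then have sub: "(\<Union>s\<in>S. ball_of E 1 s) \<subseteq> V" by blast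
  \<comment> \<open>Disjoint neighbourhoods of size at least \<open>d\<close> fit into
    \<open>V\<close> only \<open>card V / d\<close> times.\<close>
  have "d * card S \<le> (\<Sum>s\<in>S. card (ball_of E 1 s))"
    using large T by (subst mult.commute) (intro sum_bounded_below[where K = d, simplified], auto)
  also have "\<dots> = card (\<Union>s\<in>S. ball_of E 1 s)"
    using sub assms(2) finS disj
    by (intro card_UN_disjoint[symmetric]) (auto simp: disjoint_family_on_def intro: finite_subset)
  also have "\<dots> \<le> card V" using sub assms(2) by (rule card_mono[rotated])
  finally have "d * card T \<le> 3 * card V"
    using mult_le_mono2[OF T(4), of d] by linarith
  moreover have "V \<subseteq> (\<Union>u\<in>T. ball_of E 2 u)" using VU T(1) unfolding U_def by blast
  ultimately show thesis using that[of T] T(2,3) by blast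
qed

section \<open>Burning\<close>

text \<open>Fire advances one edge per step. The bound \<open>1 \<le> i\<close> excludes
  \<open>v 0\<close>, which is never lit.\<close>

lemma ball_of_on_fire:
  assumes "w \<in> ball_of (\<lambda>u w. u \<rightarrow>\<^bsub>G\<^esub> w) r (v i)" "1 \<le> i"
  shows "w \<in> on_fire G v (i + r)"
  using assms(1)
proof (induction r arbitrary: w)
  case 0
  with assms(2) show ?case by (cases i) (auto simp: ball_of_def)
next
  case (Suc r)
  then show ?case unfolding ball_of_Suc by auto
qed

lemma (in wf_digraph) burnable_if_coverable:
  assumes T: "T \<subseteq> verts G" "verts G \<subseteq> (\<Union>u\<in>T. ball_of (\<lambda>u w. u \<rightarrow>\<^bsub>G\<^esub> w) d u)"
    and cov: "coverable (\<lambda>u w. u \<rightarrow>\<^bsub>G\<^esub> w) T {..<K} T"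
  shows "burnable G (K + d)"
proof -
  let ?E = "\<lambda>u w. u \<rightarrow>\<^bsub>G\<^esub> w"
  from cov obtain c where c: "range c \<subseteq> T" "T \<subseteq> (\<Union>r<K. ball_of ?E r (c r))"
    unfolding coverable_def by blast
  \<comment> \<open>The vertex lit in step \<open>i\<close> spreads for \<open>K + d - i\<close>
    more steps, its covering radius \<open>K - i\<close> plus \<open>d\<close>. In the last
    \<open>d\<close> steps truncated subtraction yields \<open>c 0\<close>, a legal choice.\<close>
  define v where "v i = c (K - i)" for i
  have v: "\<forall>i\<in>{1..K + d}. v i \<in> verts G" unfolding v_def using c T by blast
  have "verts G \<subseteq> on_fire G v (K + d)"
  proof
    fix x assume "x \<in> verts G"
    with T obtain u where u: "u \<in> T" "x \<in> ball_of ?E d u" by blast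
    with c obtain r where r: "r < K" "u \<in> ball_of ?E r (c r)" by blast
    then have "x \<in> ball_of ?E (r + d) (v (K - r))"
      using u unfolding v_def by (auto intro: ball_of_trans)
    then have "x \<in> on_fire G v (K - r + (r + d))" using r by (intro ball_of_on_fire) auto
    then show "x \<in> on_fire G v (K + d)" using r by simp
  qed
  with v show ?thesis unfolding burnable_def using on_fire_subset_verts by blast
qed

text \<open>Without parallel arcs the heads of the arcs leaving \<open>u\<close> are distinct, and
  without loops they differ from \<open>u\<close>.\<close>

lemma (in digraph) card_closed_neighbourhood:
  assumes "u \<in> verts G"
  shows "Suc (out_degree G u) \<le> card (ball_of (\<lambda>u w. u \<rightarrow>\<^bsub>G\<^esub> w) 1 u)"
proof -
  let ?B = "ball_of (\<lambda>u w. u \<rightarrow>\<^bsub>G\<^esub> w) 1 u"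
  have inj: "inj_on (head G) (out_arcs G u)"
    by (rule inj_onI, rule no_multi_arcs) (auto simp: arc_to_ends_def)
  have fin: "finite (out_arcs G u)" by (rule finite_out_arcs)
  have sub: "insert u (head G ` out_arcs G u) \<subseteq> ?B"
    unfolding ball_of_1 by (force simp: arcs_ends_conv)
  have "?B \<subseteq> verts G"
    unfolding ball_of_1 using assms adj_in_verts by blast
  then have finB: "finite ?B" using finite_verts finite_subset by blast
  have "u \<notin> head G ` out_arcs G u" using no_loops by fastforce
  then have "Suc (out_degree G u) = card (insert u (head G ` out_arcs G u))"
    using inj fin by (simp add: out_degree_def card_image)
  also have "\<dots> \<le> card ?B" using sub finB by (rule card_mono[rotated])
  finally show ?thesis .
qed

text \<open>The slack \<open>121/200 - 3/5 = 1/200\<close> must pay for the two radii lost in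
  passing to \<open>k - 2\<close> and for the constant 6050. The threshold is \<open>1500^2\<close>:
  for \<open>k \<ge> 1500\<close>, \<open>k^2/200\<close> is at least \<open>7.5 k\<close>, which
  exceeds \<open>2.42 k + 6050\<close>.\<close>

lemma (in graph) burnable_ceiling_sqrt:
  assumes "connected G" "2250000 \<le> card (verts G)" "\<forall>v\<in>verts G. 4 \<le> out_degree G v"
  shows "burnable G (nat \<lceil>sqrt (real (card (verts G)))\<rceil>)"
proof -
  let ?E = "\<lambda>u w. u \<rightarrow>\<^bsub>G\<^esub> w"
  define n where "n = real (card (verts G))"
  define k where "k = nat \<lceil>sqrt n\<rceil>"
  have symE: "symp ?E" using arcs_ends_symmetric[OF sym_arcs] by (auto intro: sympI)
  have sc: "strongly_connected G"
    using symmetric_connected_imp_strongly_connected[OF sym_arcs assms(1)] .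
  have reach: "?E\<^sup>*\<^sup>* u w" if "u \<in> verts G" "w \<in> verts G" for u w
    using sc that unfolding strongly_connected_def reachable_conv by (auto simp: rtranclp_rtrancl_eq)
  have deg: "5 \<le> card (ball_of ?E 1 u)" if "u \<in> verts G" for u
    using card_closed_neighbourhood[OF that] assms(3) that by force
  obtain T where T: "T \<subseteq> verts G" "grown ?E T" "5 * card T \<le> 3 * card (verts G)"
    "verts G \<subseteq> (\<Union>u\<in>T. ball_of ?E 2 u)"
    by (rule distance_two_dominating_tree[OF symE finite_verts, of 5])
      (use sc reach deg in \<open>auto simp: strongly_connected_def adj_in_verts\<close>)
  obtain par dep where "rooted_tree ?E T par dep"
    using grown_rooted_tree[OF T(2) symE] by blast
  then interpret tree: rooted_tree ?E T par dep .
  have "sqrt n \<le> real k" unfolding k_def by (rule real_nat_ceiling_ge)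
  then have "(sqrt n)\<^sup>2 \<le> (real k)\<^sup>2" unfolding n_def by (intro power_mono) auto
  then have nk: "n \<le> (real k)\<^sup>2" unfolding n_def by simp
  have "1500\<^sup>2 \<le> n" unfolding n_def using assms(2) by simp
  then have "1500 \<le> sqrt n" by (intro real_le_rsqrt)
  then have k: "1500 \<le> k" using \<open>sqrt n \<le> real k\<close> by linarith
  then have "1500 * real k \<le> (real k)\<^sup>2" by (simp add: power2_eq_square)
  moreover have "real (card T) \<le> 3/5 * n" unfolding n_def using T(3) by linarith
  moreover have "(real (k - 2))\<^sup>2 = (real k)\<^sup>2 - 4 * real k + 4"
    using k by (simp add: of_nat_diff power2_diff)
  moreover have "1500 \<le> real k" using k by simp
  ultimately have "real (card T) \<le> 121/200 * (real (k - 2))\<^sup>2 - 6050"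
    using nk by linarith
  then have "coverable ?E T {..<k - 2} T"
    using tree.coverable_initial_segment tree.par_closed_tree by blast
  then have "burnable G (k - 2 + 2)" using burnable_if_coverable T by blast
  moreover have "k - 2 + 2 = k" using k by simp
  ultimately show ?thesis unfolding k_def n_def by simp
qed

theorem theorem1p3:
  shows "\<exists>n\<^sub>0 :: nat. \<forall>G :: ('a, 'b) pre_digraph.
           graph G \<longrightarrow> Digraph_Component.connected G \<longrightarrow> card (verts G) \<ge> n\<^sub>0 \<longrightarrow>
           (\<forall>v \<in> verts G. out_degree G v \<ge> 4) \<longrightarrow>
           int (burning_number G) \<le> \<lceil>sqrt (real (card (verts G)))\<rceil>"
proof (intro exI allI impI)
  fix G :: "('a, 'b) pre_digraph"
  assume "graph G" "connected G" "2250000 \<le> card (verts G)" "\<forall>v\<in>verts G. 4 \<le> out_degree G v"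
  then have "burnable G (nat \<lceil>sqrt (real (card (verts G)))\<rceil>)"
    by (rule graph.burnable_ceiling_sqrt)
  then have "burning_number G \<le> nat \<lceil>sqrt (real (card (verts G)))\<rceil>"
    unfolding burning_number_def by (rule Least_le)
  moreover have "- 1 < sqrt (real (card (verts G)))"
    using real_sqrt_ge_zero[of "real (card (verts G))"] by linarith
  then have "0 \<le> \<lceil>sqrt (real (card (verts G)))\<rceil>"
    by (simp only: zero_le_ceiling)
  ultimately show "int (burning_number G) \<le> \<lceil>sqrt (real (card (verts G)))\<rceil>"
    by linarith
qed

end
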